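(* Let $G$ be a finite simple graph with $\nu_G$ vertices $v_1,\dots,v_{\nu_G}$ and $\varepsilon_G$ edges, and let $\omega: E(G)\to\mathbb{C}$ be a weight function. Let $f(\lambda,\mu)$, $g(\lambda,\mu)$, $h(\lambda,\mu)$ be partially differentiable functions of two variables such that $f(\alpha,\beta)=0$ and $g(\alpha,\beta)+h(\alpha,\beta)=0$ for some $\alpha,\beta$. Define $$\Phi_{G_\omega}(\lambda,\mu)=\det\big[f(\lambda,\mu)I+g(\lambda,\mu)\mathcal{D}(G_\omega)+h(\lambda,\mu)\mathcal{A}(G_\omega)\big].$$ Then $$\frac{\partial \Phi_{G_\omega}}{\partial \lambda}(\alpha,\beta)=g(\alpha,\beta)^{\nu_G-1}\big[f_\lambda(\alpha,\beta)\nu_G+(g_\lambda(\alpha,\beta)+h_\lambda(\alpha,\beta))\,2\omega(G)\big]\kappa(G_\omega),$$ and $$\frac{\partial \Phi_{G_\omega}}{\partial \mu}(\alpha,\beta)=g(\alpha,\beta)^{\nu_G-1}\big[f_\mu(\alpha,\beta)\nu_G+(g_\mu(\alpha,\beta)+h_\mu(\alpha,\beta))\,2\omega(G)\big]\kappa(G_\omega).$$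
   Context: $\mathcal{A}(G_\omega)=(w_{ij})$ is the $\nu_G\times\nu_G$ weighted adjacency matrix: $w_{ij}=\omega(e)$ if $e=\{v_i,v_j\}\in E(G)$ and $0$ otherwise. $\mathcal{D}(G_\omega)$ is the diagonal matrix whose $(i,i)$ entry is the sum of the weights of the edges incident to $v_i$. $\omega(G)=\sum_{e\in E(G)}\omega(e)$. The weighted complexity is $\kappa(G_\omega)=\sum_{T}\prod_{e\in E(T)}\omega(e)$, the sum over all spanning trees $T$ of $G$. Subscripts $\lambda,\mu$ on $f,g,h$ denote partial derivatives. *)

theory Defs
  imports "HOL-Analysis.Derivative" "Jordan_Normal_Form.Determinant"
begin

definition simple_graph :: "'v set \<Rightarrow> 'v set set \<Rightarrow> bool" where
  "simple_graph V E \<longleftrightarrow> (\<forall>e\<in>E. e \<subseteq> V \<and> card e = 2)"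

definition connected_graph :: "'v set \<Rightarrow> 'v set set \<Rightarrow> bool" where
  "connected_graph V E \<longleftrightarrow>
     V \<noteq> {} \<and> (\<forall>u\<in>V. \<forall>w\<in>V. (u, w) \<in> {(a, b). {a, b} \<in> E}\<^sup>*)"

text \<open>A cycle is given by the list of its vertices, the first one not being repeated at the end.\<close>

definition is_cycle :: "'v set set \<Rightarrow> 'v list \<Rightarrow> bool" where
  "is_cycle E p \<longleftrightarrow> 3 \<le> length p \<and> distinct p \<and>
     (\<forall>i<length p. {p ! i, p ! (Suc i mod length p)} \<in> E)"

definition tree :: "'v set \<Rightarrow> 'v set set \<Rightarrow> bool" where
  "tree V T \<longleftrightarrow> simple_graph V T \<and> connected_graph V T \<and> (\<nexists>p. is_cycle T p)"

text \<open>A spanning tree has the same vertex set as the graph, so it is given by its edge set.\<close>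

definition spanning_tree :: "'v set \<Rightarrow> 'v set set \<Rightarrow> 'v set set \<Rightarrow> bool" where
  "spanning_tree V E T \<longleftrightarrow> T \<subseteq> E \<and> tree V T"

definition total_weight :: "'v set set \<Rightarrow> ('v set \<Rightarrow> complex) \<Rightarrow> complex" where
  "total_weight E \<omega> = (\<Sum>e\<in>E. \<omega> e)"

definition weighted_complexity ::
    "'v set \<Rightarrow> 'v set set \<Rightarrow> ('v set \<Rightarrow> complex) \<Rightarrow> complex" where
  "weighted_complexity V E \<omega> = (\<Sum>T\<in>{T. spanning_tree V E T}. \<Prod>e\<in>T. \<omega> e)"

text \<open>In the matrices, \<open>v 0, \<dots>, v (n - 1)\<close> enumerate the vertices.\<close>

definition weighted_adjacency ::
    "nat \<Rightarrow> (nat \<Rightarrow> 'v) \<Rightarrow> 'v set set \<Rightarrow> ('v set \<Rightarrow> complex) \<Rightarrow> complex mat" where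
  "weighted_adjacency n v E \<omega> =
     mat n n (\<lambda>(i, j). if {v i, v j} \<in> E then \<omega> {v i, v j} else 0)"

definition weighted_degree ::
    "nat \<Rightarrow> (nat \<Rightarrow> 'v) \<Rightarrow> 'v set set \<Rightarrow> ('v set \<Rightarrow> complex) \<Rightarrow> complex mat" where
  "weighted_degree n v E \<omega> =
     mat n n (\<lambda>(i, j). if i = j then (\<Sum>e\<in>{e\<in>E. v i \<in> e}. \<omega> e) else 0)"

definition Phi ::
    "nat \<Rightarrow> (nat \<Rightarrow> 'v) \<Rightarrow> 'v set set \<Rightarrow> ('v set \<Rightarrow> complex) \<Rightarrow>
     (complex \<Rightarrow> complex \<Rightarrow> complex) \<Rightarrow> (complex \<Rightarrow> complex \<Rightarrow> complex) \<Rightarrow>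
     (complex \<Rightarrow> complex \<Rightarrow> complex) \<Rightarrow> complex \<Rightarrow> complex \<Rightarrow> complex" where
  "Phi n v E \<omega> f g h x y =
     det (f x y \<cdot>\<^sub>m 1\<^sub>m n + g x y \<cdot>\<^sub>m weighted_degree n v E \<omega>
          + h x y \<cdot>\<^sub>m weighted_adjacency n v E \<omega>)"

definition partially_differentiable_on ::
    "(complex \<Rightarrow> complex \<Rightarrow> complex) \<Rightarrow> (complex \<times> complex) set \<Rightarrow> bool" where
  "partially_differentiable_on f U \<longleftrightarrow>
     (\<forall>(x, y)\<in>U. (\<lambda>s. f s y) field_differentiable at x \<and>
                 (\<lambda>t. f x t) field_differentiable at y)"

definition partial_fst :: "(complex \<Rightarrow> complex \<Rightarrow> complex) \<Rightarrow> complex \<Rightarrow> complex \<Rightarrow> complex" where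
  "partial_fst f x y = deriv (\<lambda>s. f s y) x"

definition partial_snd :: "(complex \<Rightarrow> complex \<Rightarrow> complex) \<Rightarrow> complex \<Rightarrow> complex \<Rightarrow> complex" where
  "partial_snd f x y = deriv (\<lambda>t. f x t) y"

end

theory Submission
  imports Defs
begin

text \<open>
  Adding all columns to the last column and all rows to the last row does not change the
  determinant. The last column then has entries \<open>f + (g + h) d\<^sub>i\<close>, and \<open>n f + 2 (g + h) \<omega>(G)\<close> in
  the corner; all of these vanish at the given point, and so does the rest of the last row. Hence
  the derivative of the determinant is that of the corner entry times the complementary minor,
  which is \<open>g\<^bsup>n-1\<^esup>\<close> times the reduced weighted Laplacian determinant.

  Row \<open>i\<close> of the reduced Laplacian is the sum over \<open>k\<close> of \<open>w\<^sub>i\<^sub>k (e\<^sub>i - e\<^sub>k)\<close> with \<open>e\<^sub>k = 0\<close> for the root.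
  Multilinear expansion gives a sum over all maps \<open>p\<close> from non-root vertices to vertices, weighted
  by the determinant with rows \<open>e\<^sub>i - e\<^bsub>p i\<^esub>\<close>. This determinant is 1 if every vertex is led to the
  root by \<open>p\<close>, and 0 otherwise. The maps of the first kind are the parent maps of spanning trees.
\<close>

section \<open>Parent maps and the trees they describe\<close>

text \<open>Every vertex reaches the root \<open>r\<close> under iteration of \<open>p\<close>, expressed by a depth function.\<close>

definition rooted_at :: "'a set \<Rightarrow> 'a \<Rightarrow> ('a \<Rightarrow> 'a) \<Rightarrow> bool" where
  "rooted_at V r p \<longleftrightarrow> (\<exists>d :: 'a \<Rightarrow> nat. \<forall>x\<in>V - {r}. d (p x) < d x)"

definition parent_edges :: "'a set \<Rightarrow> 'a \<Rightarrow> ('a \<Rightarrow> 'a) \<Rightarrow> 'a set set" where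
  "parent_edges V r p = (\<lambda>x. {x, p x}) ` (V - {r})"

text \<open>If two distinct vertices had the same edge, each would be the parent of the other, and
  the depth would decrease both ways.\<close>

lemma inj_on_parent_edge:
  assumes "rooted_at V r p"
  shows "inj_on (\<lambda>x. {x, p x}) (V - {r})"
proof (rule inj_onI)
  fix x y assume xy: "x \<in> V - {r}" "y \<in> V - {r}" "{x, p x} = {y, p y}"
  obtain d :: "'a \<Rightarrow> nat" where d: "\<And>z. z \<in> V - {r} \<Longrightarrow> d (p z) < d z"
    using assms unfolding rooted_at_def by blast
  show "x = y"
    using xy d[of x] d[of y] by (metis doubleton_eq_iff order_less_asym)
qed

text \<open>Following parents leads every vertex to \<open>r\<close>, and the edge relation is
  symmetric, so any two vertices are joined through \<open>r\<close>.\<close>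

lemma rooted_at_imp_connected_graph:
  assumes "rooted_at V r p" "r \<in> V" "p \<in> V - {r} \<rightarrow> V"
  shows "connected_graph V (parent_edges V r p)"
proof -
  let ?R = "{(a, b). {a, b} \<in> parent_edges V r p}"
  obtain d :: "'a \<Rightarrow> nat" where d: "\<And>z. z \<in> V - {r} \<Longrightarrow> d (p z) < d z"
    using assms unfolding rooted_at_def by blast
  have to_root: "x \<in> V \<Longrightarrow> (x, r) \<in> ?R\<^sup>*" for x
  proof (induction "d x" arbitrary: x rule: less_induct)
    case less
    show ?case
    proof (cases "x = r")
      case False
      then have x: "x \<in> V - {r}" using less.prems by blast
      then have "(p x, r) \<in> ?R\<^sup>*" using less.hyps[OF d] assms(3) by blast
      moreover have "(x, p x) \<in> ?R" using x by (auto simp: parent_edges_def)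
      ultimately show ?thesis by (meson converse_rtrancl_into_rtrancl)
    qed simp
  qed
  have "sym ?R" by (auto simp: sym_def insert_commute)
  then have "sym (?R\<^sup>*)" by (rule sym_rtrancl)
  then have "(x, y) \<in> ?R\<^sup>*" if "x \<in> V" "y \<in> V" for x y
    using to_root[OF that(1)] to_root[OF that(2)] by (meson rtrancl_trans symD)
  then show ?thesis using assms(2) unfolding connected_graph_def by blast
qed

text \<open>A vertex of maximal depth on a cycle would have its parent as both of its neighbours.\<close>

lemma rooted_at_imp_acyclic:
  assumes "rooted_at V r p"
  shows "\<not> is_cycle (parent_edges V r p) c"
proof
  assume cyc: "is_cycle (parent_edges V r p) c"
  obtain d :: "'a \<Rightarrow> nat" where d: "\<And>z. z \<in> V - {r} \<Longrightarrow> d (p z) < d z"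
    using assms unfolding rooted_at_def by blast
  define n where "n = length c"
  have n: "3 \<le> n" "distinct c" and
    edge: "\<And>i. i < n \<Longrightarrow> {c ! i, c ! (Suc i mod n)} \<in> parent_edges V r p"
    using cyc unfolding is_cycle_def n_def by auto
  have "finite ((\<lambda>i. d (c ! i)) ` {..<n})" "(\<lambda>i. d (c ! i)) ` {..<n} \<noteq> {}"
    using n by (auto simp: lessThan_empty_iff)
  from Max_in[OF this] obtain k where k: "k < n"
    and "d (c ! k) = Max ((\<lambda>i. d (c ! i)) ` {..<n})" by auto
  then have k_max: "d (c ! i) \<le> d (c ! k)" if "i < n" for i using that by auto
  have parent: "c ! i = p (c ! k)" if i: "i < n" and e: "{c ! k, c ! i} \<in> parent_edges V r p" for i
  proof -
    obtain x where "x \<in> V - {r}" "{c ! k, c ! i} = {x, p x}"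
      using e unfolding parent_edges_def by blast
    then show ?thesis using d[of x] k_max[OF i] by (auto simp: doubleton_eq_iff)
  qed
  \<comment> \<open>The neighbours of \<open>c ! k\<close> on the cycle stand at the cyclic
    positions \<open>j\<close> and \<open>i\<close>, which differ because \<open>n\<close> is at
    least 3.\<close>
  define j where "j = (if k = 0 then n - 1 else k - 1)"
  have j: "j < n" "Suc j mod n = k" using k n by (auto simp: j_def)
  define i where "i = Suc k mod n"
  have i: "i < n" using n by (auto simp: i_def)
  have "i \<noteq> j" using n k by (cases "Suc k = n") (auto simp: i_def j_def)
  have "c ! i = p (c ! k)" using parent[OF i] edge[OF k] by (simp add: i_def)
  moreover have "c ! j = p (c ! k)"
    using parent[OF j(1)] edge[OF j(1)] j(2) by (simp add: insert_commute)
  ultimately show False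
    using nth_eq_iff_index_eq[OF n(2)] i j(1) \<open>i \<noteq> j\<close> n_def by metis
qed

lemma rooted_at_imp_tree:
  assumes "rooted_at V r p" "r \<in> V" "p \<in> V - {r} \<rightarrow> V"
  shows "tree V (parent_edges V r p)"
proof -
  obtain d :: "'a \<Rightarrow> nat" where d: "\<And>z. z \<in> V - {r} \<Longrightarrow> d (p z) < d z"
    using assms unfolding rooted_at_def by blast
  have "simple_graph V (parent_edges V r p)"
    unfolding simple_graph_def parent_edges_def
  proof
    fix e assume "e \<in> (\<lambda>x. {x, p x}) ` (V - {r})"
    then obtain x where x: "x \<in> V - {r}" "e = {x, p x}" by blast
    then have "x \<noteq> p x" using d[of x] by force
    then show "e \<subseteq> V \<and> card e = 2" using x assms(3) by auto
  qed
  then show ?thesis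
    unfolding tree_def
    using rooted_at_imp_connected_graph[OF assms] rooted_at_imp_acyclic[OF assms(1)] by blast
qed

text \<open>If \<open>p x \<noteq> q x\<close>, then \<open>q x\<close> is a child of \<open>x\<close> under \<open>p\<close>, and the two maps differ at \<open>q x\<close>
  as well; following \<open>q\<close> to the root gives a contradiction.\<close>

lemma parent_edges_determine_parents:
  assumes "rooted_at V r p" "rooted_at V r q" "q \<in> V - {r} \<rightarrow> V"
    and eq: "parent_edges V r p = parent_edges V r q"
  shows "x \<in> V - {r} \<Longrightarrow> p x = q x"
proof -
  obtain d :: "'a \<Rightarrow> nat" where d: "\<And>z. z \<in> V - {r} \<Longrightarrow> d (q z) < d z"
    using assms(2) unfolding rooted_at_def by blast
  show "x \<in> V - {r} \<Longrightarrow> p x = q x"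
  proof (induction "d x" arbitrary: x rule: less_induct)
    case less
    show ?case
    proof (rule ccontr)
      assume ne: "p x \<noteq> q x"
      have "{x, q x} \<in> parent_edges V r p"
        unfolding eq using less.prems by (auto simp: parent_edges_def)
      then obtain y where "y \<in> V - {r}" "{x, q x} = {y, p y}"
        unfolding parent_edges_def by blast
      \<comment> \<open>The case \<open>y = x\<close> would give \<open>p x = q x\<close>, so
        \<open>y\<close> must be \<open>q x\<close>.\<close>
      then have y: "q x \<in> V - {r}" "p (q x) = x" using ne by (auto simp: doubleton_eq_iff)
      then have "q (q x) = x" using less.hyps[OF d[OF less.prems] y(1)] by simp
      then show False using d[OF less.prems] d[OF y(1)] by simp
    qed
  qed
qed

section \<open>Simple paths and the minimality of trees\<close>

lemma rtrancl_imp_distinct_path: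
  assumes "(a, b) \<in> {(a, b). {a, b} \<in> T}\<^sup>*"
  obtains xs where "xs \<noteq> []" "hd xs = a" "last xs = b" "distinct xs"
    "\<And>i. Suc i < length xs \<Longrightarrow> {xs ! i, xs ! Suc i} \<in> T"
proof -
  have "\<exists>xs. xs \<noteq> [] \<and> hd xs = a \<and> last xs = b \<and> distinct xs \<and>
    (\<forall>i. Suc i < length xs \<longrightarrow> {xs ! i, xs ! Suc i} \<in> T)"
    using assms
  proof (induction rule: rtrancl_induct)
    case base
    show ?case by (rule exI[of _ "[a]"]) simp
  next
    case (step y z)
    then obtain xs where xs: "xs \<noteq> []" "hd xs = a" "last xs = y" "distinct xs"
      "\<And>i. Suc i < length xs \<Longrightarrow> {xs ! i, xs ! Suc i} \<in> T" by blast
    have yz: "{y, z} \<in> T" using step by auto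
    show ?case
    proof (cases "z \<in> set xs")
      case True
      then obtain k where k: "k < length xs" "xs ! k = z" by (auto simp: in_set_conv_nth)
      \<comment> \<open>If \<open>z\<close> already lies on the path, the path is cut off at
        \<open>z\<close>.\<close>
      let ?ys = "take (Suc k) xs"
      have "last ?ys = z" using k by (simp add: take_Suc_conv_app_nth)
      then show ?thesis using xs k by (intro exI[of _ ?ys]) auto
    next
      case False
      have "{(xs @ [z]) ! i, (xs @ [z]) ! Suc i} \<in> T" if "Suc i < length (xs @ [z])" for i
      proof (cases "Suc i < length xs")
        case True
        then show ?thesis using xs(5) by (simp add: nth_append)
      next
        case False
        then have "i = length xs - 1" "Suc i = length xs" using that by auto
        then show ?thesis using yz xs(1,3) by (simp add: nth_append last_conv_nth)
      qed
      then show ?thesis using xs False by (intro exI[of _ "xs @ [z]"]) auto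
    qed
  qed
  then show ?thesis using that by blast
qed

text \<open>An edge of \<open>T\<close> missing from \<open>S\<close> would close a simple path in
  \<open>S\<close> between its endpoints to a cycle in \<open>T\<close>. Applied to parent edges,
  this shows that they exhaust the tree.\<close>

lemma connected_subgraph_of_tree:
  assumes "tree V T" "S \<subseteq> T" "connected_graph V S"
  shows "S = T"
proof (rule ccontr)
  assume "S \<noteq> T"
  then obtain e where e: "e \<in> T" "e \<notin> S" using assms(2) by blast
  then have "e \<subseteq> V" "card e = 2" using assms(1) unfolding tree_def simple_graph_def by auto
  then obtain a b where ab: "e = {a, b}" "a \<noteq> b" "a \<in> V" "b \<in> V"
    by (auto simp: card_2_iff)
  then have "(a, b) \<in> {(a, b). {a, b} \<in> S}\<^sup>*"
    using assms(3) unfolding connected_graph_def by blast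
  then obtain xs where xs: "xs \<noteq> []" "hd xs = a" "last xs = b" "distinct xs"
    "\<And>i. Suc i < length xs \<Longrightarrow> {xs ! i, xs ! Suc i} \<in> S"
    by (rule rtrancl_imp_distinct_path) blast
  have ends: "xs ! 0 = a" "xs ! (length xs - 1) = b"
    using xs by (auto simp: hd_conv_nth last_conv_nth)
  \<comment> \<open>A cycle needs three vertices: one vertex would mean \<open>a = b\<close>, and
    two would put \<open>e\<close> itself into \<open>S\<close>.\<close>
  have "length xs \<noteq> 1" using ends ab(2) by auto
  moreover have "length xs \<noteq> 2" using ends xs(5)[of 0] e(2) ab(1) by (auto simp: numeral_2_eq_2)
  moreover have "length xs \<noteq> 0" using xs(1) by simp
  ultimately have len: "3 \<le> length xs" by linarith
  have "{xs ! i, xs ! (Suc i mod length xs)} \<in> T" if "i < length xs" for i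
  proof (cases "Suc i < length xs")
    case True
    then show ?thesis using xs(5) assms(2) by auto
  next
    case False
    then have "Suc i = length xs" "i = length xs - 1" using that by auto
    then show ?thesis using ends e(1) ab(1) by (simp add: insert_commute)
  qed
  then have "is_cycle T xs" using len xs(4) unfolding is_cycle_def by blast
  then show False using assms(1) unfolding tree_def by blast
qed

section \<open>Spanning trees as rooted parent maps\<close>

text \<open>The parent map sends a vertex to a neighbour whose distance to the root is smaller.\<close>

lemma tree_obtain_parents:
  assumes "tree V T" "r \<in> V"
  obtains p where "p \<in> V - {r} \<rightarrow>\<^sub>E V" "rooted_at V r p" "parent_edges V r p = T"
proof -
  let ?R = "{(a, b). {a, b} \<in> T}"
  define d where "d x = (LEAST k. (x, r) \<in> ?R ^^ k)" for x
  have ex: "\<exists>y\<in>V. {x, y} \<in> T \<and> d y < d x" if x: "x \<in> V - {r}" for x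
  proof -
    have "(x, r) \<in> ?R\<^sup>*"
      using assms x unfolding tree_def connected_graph_def by blast
    then have "\<exists>k. (x, r) \<in> ?R ^^ k" by (rule rtrancl_imp_relpow)
    then have dx: "(x, r) \<in> ?R ^^ d x" unfolding d_def by (rule LeastI_ex)
    \<comment> \<open>As \<open>x\<close> is not the root, its distance is positive; the vertex
      after \<open>x\<close> on a shortest walk to the root is closer.\<close>
    then obtain k where k: "d x = Suc k" using x by (cases "d x") auto
    then obtain y where y: "(x, y) \<in> ?R" "(y, r) \<in> ?R ^^ k"
      using dx by (metis relpow_Suc_D2)
    then have "d y \<le> k" unfolding d_def by (intro Least_le)
    moreover have "y \<in> V" using y(1) assms(1) unfolding tree_def simple_graph_def by auto
    ultimately show ?thesis using k y(1) by auto
  qed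
  define p where "p = (\<lambda>x\<in>V - {r}. SOME y. y \<in> V \<and> {x, y} \<in> T \<and> d y < d x)"
  have p: "p x \<in> V \<and> {x, p x} \<in> T \<and> d (p x) < d x" if x: "x \<in> V - {r}" for x
  proof -
    have "\<exists>y. y \<in> V \<and> {x, y} \<in> T \<and> d y < d x" using ex[OF x] by blast
    from someI_ex[OF this] show ?thesis using x by (simp add: p_def)
  qed
  have pE: "p \<in> V - {r} \<rightarrow>\<^sub>E V" using p by (auto simp: p_def)
  have rt: "rooted_at V r p" unfolding rooted_at_def using p by blast
  have "parent_edges V r p \<subseteq> T" using p by (auto simp: parent_edges_def)
  then have "parent_edges V r p = T"
    using connected_subgraph_of_tree[OF assms(1)]
      rooted_at_imp_connected_graph[OF rt assms(2)] pE by blast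
  then show ?thesis using that pE rt by blast
qed

text \<open>Surjectivity is the choice of parents by distance to the root. For injectivity the maps
  are extensional, since the edges say nothing about values outside \<open>V - {r}\<close>.\<close>

lemma bij_betw_parent_edges:
  assumes "r \<in> V"
  shows "bij_betw (parent_edges V r)
    {p \<in> V - {r} \<rightarrow>\<^sub>E V. rooted_at V r p \<and> parent_edges V r p \<subseteq> E} {T. spanning_tree V E T}"
proof (rule bij_betw_imageI)
  show "inj_on (parent_edges V r)
    {p \<in> V - {r} \<rightarrow>\<^sub>E V. rooted_at V r p \<and> parent_edges V r p \<subseteq> E}"
  proof (rule inj_onI, clarify)
    fix p q assume pq: "p \<in> V - {r} \<rightarrow>\<^sub>E V" "q \<in> V - {r} \<rightarrow>\<^sub>E V"
      "rooted_at V r p" "rooted_at V r q" "parent_edges V r p = parent_edges V r q"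
    show "p = q"
      by (rule PiE_ext[OF pq(1,2)], rule parent_edges_determine_parents[OF pq(3,4) _ pq(5)])
        (use pq(2) in auto)
  qed
  show "parent_edges V r ` {p \<in> V - {r} \<rightarrow>\<^sub>E V. rooted_at V r p \<and> parent_edges V r p \<subseteq> E}
    = {T. spanning_tree V E T}" (is "?L = ?R")
  proof
    show "?L \<subseteq> ?R"
    proof clarify
      fix p assume p: "p \<in> V - {r} \<rightarrow>\<^sub>E V" "rooted_at V r p" "parent_edges V r p \<subseteq> E"
      then have "tree V (parent_edges V r p)"
        using rooted_at_imp_tree[OF p(2) assms] by blast
      then show "spanning_tree V E (parent_edges V r p)"
        using p(3) unfolding spanning_tree_def by blast
    qed
    show "?R \<subseteq> ?L"
    proof clarify
      fix T assume "spanning_tree V E T"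
      then have T: "T \<subseteq> E" "tree V T" unfolding spanning_tree_def by auto
      obtain p where "p \<in> V - {r} \<rightarrow>\<^sub>E V" "rooted_at V r p" "parent_edges V r p = T"
        using tree_obtain_parents[OF T(2) assms] .
      then show "T \<in> ?L" using T(1) by blast
    qed
  qed
qed

text \<open>Each tree edge is charged to its child vertex. Giving non-edges the weight 0 lets the
  sum run over all rooted maps, as those using a non-edge contribute nothing.\<close>

lemma weighted_complexity_eq_sum_parents:
  assumes "finite V" "r \<in> V"
  shows "weighted_complexity V E \<omega> = (\<Sum>p\<in>{p \<in> V - {r} \<rightarrow>\<^sub>E V. rooted_at V r p}.
    \<Prod>x\<in>V - {r}. if {x, p x} \<in> E then \<omega> {x, p x} else 0)"
proof -
  let ?P = "{p \<in> V - {r} \<rightarrow>\<^sub>E V. rooted_at V r p}"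
  let ?Q = "{p \<in> V - {r} \<rightarrow>\<^sub>E V. rooted_at V r p \<and> parent_edges V r p \<subseteq> E}"
  let ?w = "\<lambda>p x. if {x, p x} \<in> E then \<omega> {x, p x} else 0"
  have "weighted_complexity V E \<omega> = (\<Sum>p\<in>?Q. \<Prod>e\<in>parent_edges V r p. \<omega> e)"
    unfolding weighted_complexity_def
    by (rule sum.reindex_bij_betw[OF bij_betw_parent_edges[OF assms(2)], symmetric])
  also have "\<dots> = (\<Sum>p\<in>?Q. \<Prod>x\<in>V - {r}. ?w p x)"
  proof (rule sum.cong[OF refl])
    fix p assume p: "p \<in> ?Q"
    then have "(\<Prod>e\<in>parent_edges V r p. \<omega> e) = (\<Prod>x\<in>V - {r}. \<omega> {x, p x})"
      unfolding parent_edges_def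
      using prod.reindex[OF inj_on_parent_edge, of V r p \<omega>] by (simp add: o_def)
    also have "\<dots> = (\<Prod>x\<in>V - {r}. ?w p x)"
      using p by (intro prod.cong) (auto simp: parent_edges_def)
    finally show "(\<Prod>e\<in>parent_edges V r p. \<omega> e) = (\<Prod>x\<in>V - {r}. ?w p x)" .
  qed
  also have "\<dots> = (\<Sum>p\<in>?P. \<Prod>x\<in>V - {r}. ?w p x)"
  proof (rule sum.mono_neutral_left)
    have "finite (V - {r} \<rightarrow>\<^sub>E V)" using assms(1) by (simp add: finite_PiE)
    then show "finite ?P" by (rule finite_subset[rotated]) blast
    show "\<forall>p\<in>?P - ?Q. (\<Prod>x\<in>V - {r}. ?w p x) = 0"
      using assms(1) by (auto simp: parent_edges_def intro!: prod_zero)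
  qed auto
  finally show ?thesis .
qed

section \<open>Determinants with a vanishing border\<close>

lemma det_eq_det_border_sums:
  fixes A :: "'a :: comm_ring_1 mat"
  assumes A: "A \<in> carrier_mat (Suc m) (Suc m)"
  shows "det A = det (mat (Suc m) (Suc m) (\<lambda>(i, j).
    if j = m then (if i = m then \<Sum>k\<le>m. \<Sum>l\<le>m. A $$ (k, l) else \<Sum>l\<le>m. A $$ (i, l))
    else (if i = m then \<Sum>k\<le>m. A $$ (k, j) else A $$ (i, j))))" (is "_ = det ?B")
proof -
  let ?n = "Suc m"
  \<comment> \<open>Multiplication by \<open>P\<close> from the left adds all other rows to the last
    one, and by its transpose from the right does the same for columns. \<open>P\<close> is lower
    triangular with unit diagonal.\<close>
  define P :: "'a mat" where "P = mat ?n ?n (\<lambda>(i, j). if i = m \<or> i = j then 1 else 0)"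
  have P: "P \<in> carrier_mat ?n ?n" by (simp add: P_def)
  have "det P = prod_list (diag_mat P)"
    by (rule det_lower_triangular[OF _ P]) (auto simp: P_def)
  also have "\<dots> = 1" by (simp add: prod_list_diag_prod P_def)
  finally have detP: "det P = 1" .
  have PA: "(P * A) $$ (i, j) = (if i = m then \<Sum>k\<le>m. A $$ (k, j) else A $$ (i, j))"
    if "i < ?n" "j < ?n" for i j
  proof -
    have "(P * A) $$ (i, j) = (\<Sum>k<?n. (if i = m \<or> i = k then 1 else 0) * A $$ (k, j))"
      using that A P by (auto simp: scalar_prod_def P_def atLeast0LessThan intro!: sum.cong)
    then show ?thesis
      using that by (auto simp: lessThan_Suc_atMost if_distrib[of "\<lambda>x. x * _"] cong: if_cong)
  qed
  have "P * A * transpose_mat P = ?B"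
  proof (rule eq_matI)
    fix i j assume "i < dim_row ?B" "j < dim_col ?B"
    then have ij: "i < ?n" "j < ?n" by auto
    have "(P * A * transpose_mat P) $$ (i, j)
      = (\<Sum>k<?n. (P * A) $$ (i, k) * (if j = m \<or> j = k then 1 else 0))"
      using ij A P by (auto simp: scalar_prod_def P_def atLeast0LessThan intro!: sum.cong)
    also have "\<dots> = (if j = m then \<Sum>k\<le>m. (P * A) $$ (i, k) else (P * A) $$ (i, j))"
      using ij by (auto simp: lessThan_Suc_atMost if_distrib[of "\<lambda>x. _ * x"] cong: if_cong)
    also have "\<dots> = ?B $$ (i, j)"
      using ij by (auto simp: PA intro: sum.swap)
    finally show "(P * A * transpose_mat P) $$ (i, j) = ?B $$ (i, j)" .
  qed (use A P in auto)
  moreover have "det (P * A * transpose_mat P) = det A"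
    using det_mult[of "P * A" ?n "transpose_mat P"] det_mult[OF P A] det_transpose[OF P] A P detP
    by simp
  ultimately show ?thesis by simp
qed

text \<open>By the Leibniz formula the determinant is a polynomial in the entries. Continuity is all
  that is used of the cofactors below.\<close>

lemma isCont_det:
  fixes A :: "complex \<Rightarrow> complex mat"
  assumes "\<And>s. A s \<in> carrier_mat n n"
    and "\<And>i j. i < n \<Longrightarrow> j < n \<Longrightarrow> isCont (\<lambda>s. A s $$ (i, j)) a"
  shows "isCont (\<lambda>s. det (A s)) a"
proof -
  have "isCont (\<lambda>s. A s $$ (i, p i)) a" if "p permutes {0..<n}" "i \<in> {0..<n}" for p i
    using that assms(2) permutes_in_image[OF that(1), of i] by auto
  then show ?thesis
    unfolding det_def'[OF assms(1)] by (intro continuous_intros) auto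
qed

text \<open>In the Laplace expansion along the last column every entry vanishes at \<open>a\<close>, so only the
  entries need to be differentiated; the last row kills all cofactors but one.\<close>

lemma has_field_derivative_det_zero_border:
  fixes A :: "complex \<Rightarrow> complex mat"
  assumes A: "\<And>s. A s \<in> carrier_mat (Suc m) (Suc m)"
    and cont: "\<And>i j. i \<le> m \<Longrightarrow> j \<le> m \<Longrightarrow> isCont (\<lambda>s. A s $$ (i, j)) a"
    and row0: "\<And>j. j \<le> m \<Longrightarrow> A a $$ (m, j) = 0"
    and col0: "\<And>i. i \<le> m \<Longrightarrow> A a $$ (i, m) = 0"
    and deriv: "\<And>i. i \<le> m \<Longrightarrow> ((\<lambda>s. A s $$ (i, m)) has_field_derivative c i) (at a)"
  shows "((\<lambda>s. det (A s)) has_field_derivative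
    c m * det (mat m m (\<lambda>(i, j). A a $$ (i, j)))) (at a)"
proof -
  have cof: "isCont (\<lambda>s. cofactor (A s) i m) a" if "i \<le> m" for i
  proof -
    have "isCont (\<lambda>s. det (mat_delete (A s) i m)) a"
    proof (rule isCont_det)
      show "mat_delete (A s) i m \<in> carrier_mat m m" for s
        using mat_delete_carrier[OF A[of s], of i m] by simp
      \<comment> \<open>The deleted column is the last one, so column indices stay; row indices from
        \<open>i\<close> on shift by one.\<close>
      show "isCont (\<lambda>s. mat_delete (A s) i m $$ (k, l)) a" if "k < m" "l < m" for k l
        using A that cont[of "if k < i then k else Suc k" l]
        by (simp add: mat_delete_def carrier_matD[OF A])
    qed
    then show ?thesis unfolding cofactor_def by (intro continuous_intros)
  qed
  have cof0: "cofactor (A a) i m = 0" if "i < m" for i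
  proof -
    let ?B = "mat_delete (A a) i m"
    have B: "?B \<in> carrier_mat m m" using mat_delete_carrier[OF A[of a], of i m] by simp
    \<comment> \<open>Deleting row \<open>i < m\<close> moves the zero last row of
      \<open>A a\<close> to position \<open>m - 1\<close>.\<close>
    have "?B $$ (m - 1, j) = 0" if "j < m" for j
      using that \<open>i < m\<close> row0[of j] by (simp add: mat_delete_def carrier_matD[OF A])
    then have "(\<Prod>k = 0..<m. ?B $$ (k, p k)) = 0" if "p permutes {0..<m}" for p
      using that \<open>i < m\<close> permutes_in_image[OF that, of "m - 1"]
      by (intro prod_zero bexI[of _ "m - 1"]) auto
    then show ?thesis unfolding cofactor_def det_def'[OF B] by (subst sum.neutral) auto
  qed
  have corner: "cofactor (A a) m m = det (mat m m (\<lambda>(i, j). A a $$ (i, j)))"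
  proof -
    have "mat_delete (A a) m m = mat m m (\<lambda>(i, j). A a $$ (i, j))"
      by (rule eq_matI) (auto simp: mat_delete_def carrier_matD[OF A])
    then show ?thesis by (simp add: cofactor_def)
  qed
  have term_deriv: "((\<lambda>s. A s $$ (i, m) * cofactor (A s) i m) has_field_derivative
    c i * cofactor (A a) i m) (at a)" if i: "i \<le> m" for i
  proof -
    \<comment> \<open>Since \<open>A a $$ (i, m)\<close> is 0, this is the difference quotient of
      the whole product, so the cofactor need only be continuous.\<close>
    have "(\<lambda>s. (A s $$ (i, m) - A a $$ (i, m)) / (s - a) * cofactor (A s) i m)
      \<midarrow>a\<rightarrow> c i * cofactor (A a) i m"
      using deriv[OF i] cof[OF i]
      by (intro tendsto_mult) (simp_all add: has_field_derivative_iff isCont_def)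
    then show ?thesis
      by (simp add: has_field_derivative_iff col0[OF i])
  qed
  have "((\<lambda>s. \<Sum>i<Suc m. A s $$ (i, m) * cofactor (A s) i m) has_field_derivative
    (\<Sum>i<Suc m. c i * cofactor (A a) i m)) (at a)"
    by (intro DERIV_sum term_deriv) auto
  moreover have "(\<Sum>i<Suc m. c i * cofactor (A a) i m)
    = c m * det (mat m m (\<lambda>(i, j). A a $$ (i, j)))"
    using cof0 corner by simp
  ultimately show ?thesis using laplace_expansion_column[OF A, of m] by simp
qed

section \<open>The weighted matrix-tree theorem\<close>

text \<open>The indicator vector of the indices that never reach the root lies in the kernel.\<close>

lemma det_id_minus_parent_map_unrooted:
  fixes p :: "nat \<Rightarrow> nat"
  assumes "\<And>i. i < m \<Longrightarrow> p i \<le> m" "\<not> rooted_at {..m} m p"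
  shows "det (mat m m (\<lambda>(i, j). (if i = j then 1 else 0) - (if p i = j then 1 else 0)) :: complex mat) = 0"
    (is "det ?A = 0")
proof -
  define reach where "reach i \<longleftrightarrow> (\<exists>k. (p ^^ k) i = m)" for i
  have reach_m: "reach m" unfolding reach_def by (rule exI[of _ 0]) simp
  have reach_p: "reach (p i) \<longleftrightarrow> reach i" if i: "i < m" for i
  proof
    assume "reach (p i)"
    then obtain k where "(p ^^ k) (p i) = m" unfolding reach_def by blast
    then have "(p ^^ Suc k) i = m" by (simp add: funpow_swap1)
    then show "reach i" unfolding reach_def by blast
  next
    assume "reach i"
    then obtain k where k: "(p ^^ k) i = m" unfolding reach_def by blast
    then obtain l where "k = Suc l" using i by (cases k) auto
    then have "(p ^^ l) (p i) = m" using k by (simp add: funpow_swap1)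
    then show "reach (p i)" unfolding reach_def by blast
  qed
  have "\<exists>i<m. \<not> reach i"
  proof (rule ccontr)
    assume "\<not> (\<exists>i<m. \<not> reach i)"
    then have all: "reach i" if "i < m" for i using that by blast
    \<comment> \<open>If every index reached \<open>m\<close>, the number of steps to
      \<open>m\<close> would be a depth function.\<close>
    define d where "d i = (LEAST k. (p ^^ k) i = m)" for i
    have "d (p i) < d i" if i: "i < m" for i
    proof -
      have "(p ^^ d i) i = m"
        unfolding d_def using all[OF i] unfolding reach_def by (rule LeastI_ex)
      then obtain l where "d i = Suc l" "(p ^^ l) (p i) = m"
        using i by (cases "d i") (auto simp: funpow_swap1)
      moreover from this have "d (p i) \<le> l" unfolding d_def by (intro Least_le)
      ultimately show ?thesis by simp
    qed
    then have "rooted_at {..m} m p" unfolding rooted_at_def by (intro exI[of _ d]) auto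
    then show False using assms(2) by blast
  qed
  then obtain i0 where i0: "i0 < m" "\<not> reach i0" by blast
  define x :: "complex vec" where "x = vec m (\<lambda>i. if reach i then 0 else 1)"
  have "x \<noteq> 0\<^sub>v m"
  proof
    assume "x = 0\<^sub>v m"
    then have "x $ i0 = 0" using i0 by simp
    then show False using i0 by (simp add: x_def)
  qed
  moreover have "?A *\<^sub>v x = 0\<^sub>v m"
  proof (rule eq_vecI)
    fix i assume "i < dim_vec (0\<^sub>v m :: complex vec)"
    then have i: "i < m" by simp
    have "(?A *\<^sub>v x) $ i = (\<Sum>j<m. ((if i = j then 1 else 0) - (if p i = j then 1 else 0))
        * (if reach j then 0 else 1))"
      using i by (auto simp: scalar_prod_def x_def atLeast0LessThan intro!: sum.cong)
    also have "\<dots> = (\<Sum>j<m. if i = j then (if reach j then 0 else 1) else 0)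
        - (\<Sum>j<m. if p i = j then (if reach j then 0 else 1) else 0)"
      unfolding sum_subtractf[symmetric] by (intro sum.cong) auto
    \<comment> \<open>When \<open>p i = m\<close>, no \<open>j < m\<close> matches in the second
      sum; this agrees with the right-hand side because \<open>m\<close> reaches itself.\<close>
    also have "\<dots> = (if reach i then 0 else 1) - (if reach (p i) then 0 else 1)"
      using i assms(1)[OF i] reach_m by (cases "p i = m") auto
    also have "\<dots> = 0" using reach_p[OF i] by simp
    finally show "(?A *\<^sub>v x) $ i = 0\<^sub>v m $ i" using i by simp
  qed simp
  moreover have "x \<in> carrier_vec m" by (simp add: x_def)
  ultimately show ?thesis
    using det_0_iff_vec_prod_zero_field[of ?A m] by auto
qed

text \<open>A non-identity permutation contributing to the determinant would move an index of least
  depth to its parent, which has smaller depth and is moved as well.\<close>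

lemma det_id_minus_parent_map_rooted:
  fixes p :: "nat \<Rightarrow> nat"
  assumes "rooted_at {..m} m p"
  shows "det (mat m m (\<lambda>(i, j). (if i = j then 1 else 0) - (if p i = j then 1 else 0)) :: complex mat) = 1"
    (is "det ?A = 1")
proof -
  obtain d :: "nat \<Rightarrow> nat" where "\<forall>i\<in>{..m} - {m}. d (p i) < d i"
    using assms unfolding rooted_at_def by blast
  then have d: "d (p i) < d i" if "i < m" for i using that by simp
  have zero: "(\<Prod>i = 0..<m. ?A $$ (i, \<sigma> i)) = 0" if \<sigma>: "\<sigma> permutes {0..<m}" "\<sigma> \<noteq> id" for \<sigma>
  proof (rule ccontr)
    assume nz: "(\<Prod>i = 0..<m. ?A $$ (i, \<sigma> i)) \<noteq> 0"
    have step: "\<sigma> i = p i" if "i < m" "\<sigma> i \<noteq> i" for i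
    proof -
      have "\<sigma> i < m" using permutes_in_image[OF \<sigma>(1), of i] that by simp
      moreover have "?A $$ (i, \<sigma> i) \<noteq> 0" using nz that by (auto simp: prod_zero_iff)
      ultimately show ?thesis using that by (auto split: if_splits)
    qed
    have "\<sigma> i = i" if "i < m" for i
      using that
    proof (induction "d i" arbitrary: i rule: less_induct)
      case less
      show ?case
      proof (rule ccontr)
        assume ne: "\<sigma> i \<noteq> i"
        have "\<sigma> i < m" using permutes_in_image[OF \<sigma>(1), of i] less.prems by simp
        moreover have "d (\<sigma> i) < d i" using step[OF less.prems ne] d[OF less.prems] by simp
        ultimately have "\<sigma> (\<sigma> i) = \<sigma> i" using less.hyps by blast
        then show False using ne permutes_inj[OF \<sigma>(1)] by (meson injD)
      qed
    qed
    moreover have "\<sigma> i = i" if "\<not> i < m" for i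
      using permutes_not_in[OF \<sigma>(1), of i] that by simp
    ultimately have "\<sigma> = id" by (metis ext id_apply)
    then show False using \<sigma>(2) by blast
  qed
  have diag: "(\<Prod>i = 0..<m. ?A $$ (i, id i)) = 1"
  proof (rule prod.neutral, rule ballI)
    fix i assume i: "i \<in> {0..<m}"
    then have "p i \<noteq> i" using d[of i] by auto
    then show "?A $$ (i, id i) = 1" using i by simp
  qed
  have "det ?A = (\<Sum>\<sigma>\<in>{\<sigma>. \<sigma> permutes {0..<m}}. signof \<sigma> * (\<Prod>i = 0..<m. ?A $$ (i, \<sigma> i)))"
    by (rule det_def') simp
  also have "\<dots> = (\<Sum>\<sigma>\<in>{id}. signof \<sigma> * (\<Prod>i = 0..<m. ?A $$ (i, \<sigma> i)))"
  proof (rule sum.mono_neutral_right)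
    show "\<forall>\<sigma>\<in>{\<sigma>. \<sigma> permutes {0..<m}} - {id}. signof \<sigma> * (\<Prod>i = 0..<m. ?A $$ (i, \<sigma> i)) = 0"
      using zero by (metis (lifting) DiffE insertI1 mem_Collect_eq mult_zero_right)
  qed (auto simp: finite_permutations permutes_id)
  also have "\<dots> = 1" using diag by simp
  finally show ?thesis .
qed

text \<open>This is a directed matrix-tree theorem with root \<open>m\<close>. Diagonal weights
  \<open>w i i\<close> cancel on the left, and on the right a rooted map has no fixed point below
  \<open>m\<close>.\<close>

lemma det_reduced_laplacian:
  fixes w :: "nat \<Rightarrow> nat \<Rightarrow> complex"
  shows "det (mat m m (\<lambda>(i, j). (if i = j then \<Sum>k\<le>m. w i k else 0) - w i j))
    = (\<Sum>p\<in>{p. (\<forall>i<m. p i \<le> m) \<and> (\<forall>i\<ge>m. p i = i) \<and> rooted_at {..m} m p}. \<Prod>i<m. w i (p i))"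
    (is "det ?L = _")
proof -
  \<comment> \<open>\<open>u i k\<close> is the difference of the unit vectors at \<open>i\<close>
    and \<open>k\<close>; for \<open>k = m\<close> the second one vanishes, as coordinates stop
    below \<open>m\<close>.\<close>
  define u :: "nat \<Rightarrow> nat \<Rightarrow> complex vec" where
    "u i k = vec m (\<lambda>j. (if i = j then 1 else 0) - (if k = j then 1 else 0))" for i k
  have u: "u i k \<in> carrier_vec m" for i k by (simp add: u_def)
  \<comment> \<open>The maps are the identity from \<open>m\<close> on, the form in which
    \<open>det_linear_rows_sum\<close> indexes the expansion.\<close>
  let ?F = "{p. (\<forall>i\<in>{0..<m}. p i \<in> {..m}) \<and> (\<forall>i. i \<notin> {0..<m} \<longrightarrow> p i = i)}"
  have fin: "finite ?F" by (rule finite_bounded_functions) auto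
  have "?L = mat\<^sub>r m m (\<lambda>i. finsum_vec TYPE(complex) m (\<lambda>k. w i k \<cdot>\<^sub>v u i k) {..m})"
  proof (rule eq_matI)
    fix i j assume "i < dim_row (mat\<^sub>r m m (\<lambda>i. finsum_vec TYPE(complex) m (\<lambda>k. w i k \<cdot>\<^sub>v u i k) {..m}))"
      "j < dim_col (mat\<^sub>r m m (\<lambda>i. finsum_vec TYPE(complex) m (\<lambda>k. w i k \<cdot>\<^sub>v u i k) {..m}))"
    then have ij: "i < m" "j < m" by auto
    have "finsum_vec TYPE(complex) m (\<lambda>k. w i k \<cdot>\<^sub>v u i k) {..m} $ j
      = (\<Sum>k\<le>m. (w i k \<cdot>\<^sub>v u i k) $ j)"
      using ij u by (intro index_finsum_vec) auto
    also have "\<dots> = (\<Sum>k\<le>m. (if i = j then w i k else 0) - (if k = j then w i k else 0))"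
      using ij by (intro sum.cong) (auto simp: u_def)
    also have "\<dots> = (if i = j then \<Sum>k\<le>m. w i k else 0) - w i j"
      unfolding sum_subtractf using ij by auto
    finally show "?L $$ (i, j)
      = mat\<^sub>r m m (\<lambda>i. finsum_vec TYPE(complex) m (\<lambda>k. w i k \<cdot>\<^sub>v u i k) {..m}) $$ (i, j)"
      using ij by simp
  qed auto
  then have "det ?L = (\<Sum>p\<in>?F. det (mat\<^sub>r m m (\<lambda>i. w i (p i) \<cdot>\<^sub>v u i (p i))))"
    using det_linear_rows_sum[of "{..m}" "\<lambda>i k. w i k \<cdot>\<^sub>v u i k" m] u by auto
  also have "\<dots> = (\<Sum>p\<in>?F. (\<Prod>i<m. w i (p i)) * (if rooted_at {..m} m p then 1 else 0))"
  proof (rule sum.cong[OF refl])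
    fix p assume p: "p \<in> ?F"
    have "mat\<^sub>r m m (\<lambda>i. u i (p i))
      = mat m m (\<lambda>(i, j). (if i = j then 1 else 0) - (if p i = j then 1 else 0))"
      by (rule eq_matI) (auto simp: u_def)
    then have "det (mat\<^sub>r m m (\<lambda>i. u i (p i))) = (if rooted_at {..m} m p then 1 else 0)"
      using det_id_minus_parent_map_rooted[of m p] det_id_minus_parent_map_unrooted[of m p] p by auto
    then show "det (mat\<^sub>r m m (\<lambda>i. w i (p i) \<cdot>\<^sub>v u i (p i)))
      = (\<Prod>i<m. w i (p i)) * (if rooted_at {..m} m p then 1 else 0)"
      using det_rows_mul[of "\<lambda>i. u i (p i)" m "\<lambda>i. w i (p i)"] u by (simp add: atLeast0LessThan)
  qed
  also have "\<dots> = (\<Sum>p\<in>{p\<in>?F. rooted_at {..m} m p}. \<Prod>i<m. w i (p i))"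
    using fin by (intro sum.mono_neutral_cong_right) auto
  also have "{p\<in>?F. rooted_at {..m} m p}
    = {p. (\<forall>i<m. p i \<le> m) \<and> (\<forall>i\<ge>m. p i = i) \<and> rooted_at {..m} m p}" by auto
  finally show ?thesis .
qed

text \<open>The determinant expands over rooted maps on indices and the complexity over rooted maps
  on vertices; the enumeration \<open>v\<close> matches them, with \<open>v m\<close> as
  root.\<close>

lemma weighted_complexity_eq_det:
  fixes v :: "nat \<Rightarrow> 'v" and E :: "'v set set" and \<omega> :: "'v set \<Rightarrow> complex"
  assumes v: "bij_betw v {..m} V"
  defines "w \<equiv> \<lambda>i j. if {v i, v j} \<in> E then \<omega> {v i, v j} else 0"
  shows "det (mat m m (\<lambda>(i, j). (if i = j then \<Sum>k\<le>m. w i k else 0) - w i j))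
    = weighted_complexity V E \<omega>"
proof -
  define u where "u = inv_into {..m} v"
  define r where "r = v m"
  have inj: "inj_on v {..m}" and img: "v ` {..m} = V" using v by (auto simp: bij_betw_def)
  have uv: "u (v i) = i" if "i \<le> m" for i using inj that by (simp add: u_def)
  have vu: "v (u x) = x" if "x \<in> V" for x using that img by (metis f_inv_into_f u_def)
  have u_le: "u x \<le> m" if "x \<in> V" for x using that img by (metis inv_into_into u_def atMost_iff)
  have u_less: "u x < m" if "x \<in> V - {r}" for x
    using that u_le[of x] vu[of x] r_def by (metis DiffD1 DiffD2 insertI1 order_le_less)
  have vV: "v i \<in> V" if "i \<le> m" for i using that img by auto
  have vr: "v i \<in> V - {r}" if "i < m" for i
    using that vV[of i] uv[of i] uv[of m] r_def by force
  have bij: "bij_betw v {..<m} (V - {r})"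
    unfolding bij_betw_def
  proof
    show "inj_on v {..<m}" by (rule inj_on_subset[OF inj]) auto
    show "v ` {..<m} = V - {r}" using vr u_less vu by (auto intro!: image_eqI[of _ v "u _"])
  qed
  have "finite V" "r \<in> V" using img vV by (auto simp: r_def)
  have root_v: "rooted_at V r (\<lambda>x\<in>V - {r}. v (p (u x)))"
    if p: "\<forall>i<m. p i \<le> m" "rooted_at {..m} m p" for p
  proof -
    obtain d :: "nat \<Rightarrow> nat" where d: "\<forall>i\<in>{..m} - {m}. d (p i) < d i"
      using p unfolding rooted_at_def by blast
    have "d (u ((\<lambda>x\<in>V - {r}. v (p (u x))) x)) < d (u x)" if x: "x \<in> V - {r}" for x
      using d p(1) u_less[OF x] x uv by simp
    then show ?thesis unfolding rooted_at_def by (intro exI[of _ "\<lambda>x. d (u x)"] ballI)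
  qed
  have root_u: "rooted_at {..m} m (\<lambda>i. if i < m then u (q (v i)) else i)"
    if q: "q \<in> V - {r} \<rightarrow>\<^sub>E V" "rooted_at V r q" for q
  proof -
    obtain d :: "'v \<Rightarrow> nat" where d: "\<forall>x\<in>V - {r}. d (q x) < d x"
      using q unfolding rooted_at_def by blast
    have "d (v (if i < m then u (q (v i)) else i)) < d (v i)" if "i \<in> {..m} - {m}" for i
    proof -
      have "i < m" using that by auto
      then show ?thesis using d vr[of i] PiE_mem[OF q(1) vr[of i]] vu by simp
    qed
    then show ?thesis unfolding rooted_at_def by (intro exI[of _ "\<lambda>i. d (v i)"] ballI)
  qed
  let ?N = "{p. (\<forall>i<m. p i \<le> m) \<and> (\<forall>i\<ge>m. p i = i) \<and> rooted_at {..m} m p}"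
  have "(\<Sum>p\<in>?N. \<Prod>i<m. w i (p i)) = (\<Sum>q\<in>{q \<in> V - {r} \<rightarrow>\<^sub>E V. rooted_at V r q}.
    \<Prod>x\<in>V - {r}. if {x, q x} \<in> E then \<omega> {x, q x} else 0)"
  \<comment> \<open>Both witnesses conjugate by \<open>v\<close>. They differ in the default values:
    the identity for index maps, \<open>undefined\<close> for vertex maps.\<close>
  proof (rule sum.reindex_bij_witness[where
        i = "\<lambda>q i. if i < m then u (q (v i)) else i" and
        j = "\<lambda>p. \<lambda>x\<in>V - {r}. v (p (u x))"])
    fix p assume p: "p \<in> ?N"
    show "(\<lambda>i. if i < m then u ((\<lambda>x\<in>V - {r}. v (p (u x))) (v i)) else i) = p"
      using p vr uv by (intro ext) auto
    show "(\<lambda>x\<in>V - {r}. v (p (u x))) \<in> {q \<in> V - {r} \<rightarrow>\<^sub>E V. rooted_at V r q}"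
      using p root_v[of p] u_less vV by auto
    show "(\<Prod>x\<in>V - {r}. if {x, (\<lambda>x\<in>V - {r}. v (p (u x))) x} \<in> E
        then \<omega> {x, (\<lambda>x\<in>V - {r}. v (p (u x))) x} else 0) = (\<Prod>i<m. w i (p i))"
      unfolding prod.reindex_bij_betw[OF bij, symmetric]
      using vr uv by (intro prod.cong) (auto simp: w_def)
  next
    fix q assume q: "q \<in> {q \<in> V - {r} \<rightarrow>\<^sub>E V. rooted_at V r q}"
    then have qE: "q \<in> V - {r} \<rightarrow>\<^sub>E V" by blast
    show "(\<lambda>x\<in>V - {r}. v (if u x < m then u (q (v (u x))) else u x)) = q"
    proof
      fix x
      show "(\<lambda>x\<in>V - {r}. v (if u x < m then u (q (v (u x))) else u x)) x = q x"
      proof (cases "x \<in> V - {r}")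
        case True
        then show ?thesis using u_less[OF True] PiE_mem[OF qE True] vu by simp
      next
        case False
        then show ?thesis using PiE_arb[OF qE False] by (auto simp: restrict_def)
      qed
    qed
    show "(\<lambda>i. if i < m then u (q (v i)) else i) \<in> ?N"
      using q root_u[OF qE] u_le PiE_mem[OF qE vr] by auto
  qed
  then show ?thesis
    unfolding det_reduced_laplacian
    using weighted_complexity_eq_sum_parents[OF \<open>finite V\<close> \<open>r \<in> V\<close>, of E \<omega>] by simp
qed

section \<open>Degree sums and the derivative of the determinant\<close>

lemma sum_incident_edges:
  fixes v :: "nat \<Rightarrow> 'v" and \<omega> :: "'v set \<Rightarrow> complex"
  assumes "simple_graph V E" and v: "bij_betw v {..m} V" and i: "i \<le> m"
  shows "(\<Sum>e\<in>{e\<in>E. v i \<in> e}. \<omega> e) = (\<Sum>j\<le>m. if {v i, v j} \<in> E then \<omega> {v i, v j} else 0)"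
proof -
  have inj: "inj_on v {..m}" and img: "v ` {..m} = V" using v by (auto simp: bij_betw_def)
  \<comment> \<open>An edge at \<open>v i\<close> has exactly one other endpoint, so these edges are
    indexed by the neighbours of \<open>v i\<close>.\<close>
  have "{e\<in>E. v i \<in> e} = (\<lambda>j. {v i, v j}) ` {j\<in>{..m}. {v i, v j} \<in> E}"
  proof (intro equalityI subsetI)
    fix e assume e: "e \<in> {e\<in>E. v i \<in> e}"
    then have "card e = 2" "e \<subseteq> V" using assms(1) by (auto simp: simple_graph_def)
    then obtain y where "e = {v i, y}" "y \<in> V" using e by (auto simp: card_2_iff)
    then show "e \<in> (\<lambda>j. {v i, v j}) ` {j\<in>{..m}. {v i, v j} \<in> E}" using e img by auto
  qed auto
  moreover have "inj_on (\<lambda>j. {v i, v j}) {j\<in>{..m}. {v i, v j} \<in> E}"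
    using inj i by (auto simp: inj_on_def doubleton_eq_iff)
  ultimately have "(\<Sum>e\<in>{e\<in>E. v i \<in> e}. \<omega> e) = (\<Sum>j\<in>{j\<in>{..m}. {v i, v j} \<in> E}. \<omega> {v i, v j})"
    by (simp add: sum.reindex)
  also have "\<dots> = (\<Sum>j\<le>m. if {v i, v j} \<in> E then \<omega> {v i, v j} else 0)"
    by (rule sum.mono_neutral_cong_left) auto
  finally show ?thesis .
qed

text \<open>The weighted handshake identity: exchanging the sums counts each edge once for each of
  its two endpoints.\<close>

lemma sum_weighted_degrees:
  fixes v :: "nat \<Rightarrow> 'v" and \<omega> :: "'v set \<Rightarrow> complex"
  assumes "simple_graph V E" and v: "bij_betw v {..m} V"
  shows "(\<Sum>i\<le>m. \<Sum>e\<in>{e\<in>E. v i \<in> e}. \<omega> e) = 2 * total_weight E \<omega>"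
proof -
  have inj: "inj_on v {..m}" and img: "v ` {..m} = V" using v by (auto simp: bij_betw_def)
  have "finite V" using img by auto
  moreover have "E \<subseteq> Pow V" using assms(1) by (auto simp: simple_graph_def)
  ultimately have fin: "finite E" by (meson finite_Pow_iff finite_subset)
  have "(\<Sum>i\<le>m. \<Sum>e\<in>{e\<in>E. v i \<in> e}. \<omega> e) = (\<Sum>x\<in>V. \<Sum>e\<in>{e\<in>E. x \<in> e}. \<omega> e)"
    by (rule sum.reindex_bij_betw[OF v])
  also have "\<dots> = (\<Sum>e\<in>E. \<Sum>x\<in>{x\<in>V. x \<in> e}. \<omega> e)"
    by (rule sum.swap_restrict[OF \<open>finite V\<close> fin])
  also have "\<dots> = (\<Sum>e\<in>E. 2 * \<omega> e)"
  proof (rule sum.cong[OF refl])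
    fix e assume "e \<in> E"
    then have "{x\<in>V. x \<in> e} = e" "card e = 2" using assms(1) by (auto simp: simple_graph_def)
    then show "(\<Sum>x\<in>{x\<in>V. x \<in> e}. \<omega> e) = 2 * \<omega> e" by simp
  qed
  finally show ?thesis by (simp add: total_weight_def sum_distrib_left)
qed

text \<open>\<open>F\<close>, \<open>G\<close> and \<open>H\<close> stand for the three coefficient
  functions with one argument frozen, so both partial derivatives are instances.\<close>

lemma has_field_derivative_det_degree_adjacency:
  fixes v :: "nat \<Rightarrow> 'v" and \<omega> :: "'v set \<Rightarrow> complex" and F G H :: "complex \<Rightarrow> complex"
  assumes "finite V" and E: "simple_graph V E" and v: "bij_betw v {0..<card V} V"
    and F: "(F has_field_derivative F') (at a)"
    and G: "(G has_field_derivative G') (at a)"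
    and H: "(H has_field_derivative H') (at a)"
    and zero: "F a = 0" "G a + H a = 0"
  shows "((\<lambda>s. det (F s \<cdot>\<^sub>m 1\<^sub>m (card V) + G s \<cdot>\<^sub>m weighted_degree (card V) v E \<omega>
        + H s \<cdot>\<^sub>m weighted_adjacency (card V) v E \<omega>)) has_field_derivative
      G a ^ (card V - 1) * (F' * of_nat (card V) + (G' + H') * (2 * total_weight E \<omega>))
        * weighted_complexity V E \<omega>) (at a)"
proof (cases "card V")
  case 0
  \<comment> \<open>The empty graph does not count as connected, so it has no spanning tree; the
    claimed derivative 0 is that of the constant determinant of size 0.\<close>
  then have "V = {}" using assms(1) by simp
  then have "weighted_complexity V E \<omega> = 0"
    by (simp add: weighted_complexity_def spanning_tree_def tree_def connected_graph_def)
  then show ?thesis using 0 by (simp add: weighted_degree_def weighted_adjacency_def)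
next
  case (Suc m)
  have v': "bij_betw v {..m} V" using v Suc by (simp add: atLeast0LessThan lessThan_Suc_atMost)
  define w where "w i j = (if {v i, v j} \<in> E then \<omega> {v i, v j} else 0)" for i j
  define deg where "deg i = (\<Sum>e\<in>{e\<in>E. v i \<in> e}. \<omega> e)" for i
  define M where "M s = F s \<cdot>\<^sub>m 1\<^sub>m (card V) + G s \<cdot>\<^sub>m weighted_degree (card V) v E \<omega>
        + H s \<cdot>\<^sub>m weighted_adjacency (card V) v E \<omega>" for s
  have M: "M s \<in> carrier_mat (Suc m) (Suc m)" for s
    by (simp add: M_def Suc weighted_degree_def weighted_adjacency_def)
  have Mij: "M s $$ (i, j) = (if i = j then F s + G s * deg i else 0) + H s * w i j"
    if "i \<le> m" "j \<le> m" for s i j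
    using that by (simp add: M_def Suc weighted_degree_def weighted_adjacency_def deg_def w_def)
  have w_sym: "w i j = w j i" for i j by (simp add: w_def insert_commute)
  have deg: "deg i = (\<Sum>j\<le>m. w i j)" if "i \<le> m" for i
    unfolding deg_def w_def by (rule sum_incident_edges[OF E v' that])
  have row: "(\<Sum>j\<le>m. M s $$ (i, j)) = F s + (G s + H s) * deg i" if "i \<le> m" for s i
    using that deg[OF that] by (simp add: Mij sum.distrib sum_distrib_left[symmetric] algebra_simps)
  have col: "(\<Sum>i\<le>m. M s $$ (i, j)) = F s + (G s + H s) * deg j" if "j \<le> m" for s j
    using that deg[OF that]
    by (simp add: Mij sum.distrib sum_distrib_left[symmetric] w_sym[of _ j] algebra_simps)
  have total: "(\<Sum>i\<le>m. F s + (G s + H s) * deg i)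
      = F s * of_nat (card V) + (G s + H s) * (2 * total_weight E \<omega>)" for s
    using sum_weighted_degrees[OF E v', of \<omega>]
    by (simp add: sum.distrib sum_distrib_left[symmetric] deg_def[symmetric] Suc algebra_simps)
  \<comment> \<open>\<open>B s\<close> is \<open>M s\<close> with its border replaced by the
    evaluated row, column and total sums. The border entries are combinations of \<open>F s\<close>
    and \<open>G s + H s\<close>, hence vanish at \<open>a\<close>.\<close>
  define B where "B s = mat (Suc m) (Suc m) (\<lambda>(i, j).
      if j = m then (if i = m then F s * of_nat (card V) + (G s + H s) * (2 * total_weight E \<omega>)
        else F s + (G s + H s) * deg i)
      else (if i = m then F s + (G s + H s) * deg j
        else (if i = j then F s + G s * deg i else 0) + H s * w i j))" for s
  have detM: "det (M s) = det (B s)" for s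
  proof -
    have "mat (Suc m) (Suc m) (\<lambda>(i, j).
      if j = m then (if i = m then \<Sum>k\<le>m. \<Sum>l\<le>m. M s $$ (k, l) else \<Sum>l\<le>m. M s $$ (i, l))
      else (if i = m then \<Sum>k\<le>m. M s $$ (k, j) else M s $$ (i, j))) = B s"
      by (rule eq_matI, auto simp: B_def total row col) (simp_all add: Mij)
    then show ?thesis using det_eq_det_border_sums[OF M, of s] by simp
  qed
  have cont: "isCont F a" "isCont G a" "isCont H a"
    using F G H by (auto intro: DERIV_isCont)
  \<comment> \<open>\<open>c i\<close> is the derivative at \<open>a\<close> of entry
    \<open>i\<close> of the last column of \<open>B\<close>; only \<open>c m\<close> enters the
    result.\<close>
  define c where "c i = (if i = m then F' * of_nat (card V) + (G' + H') * (2 * total_weight E \<omega>)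
      else F' + (G' + H') * deg i)" for i
  have "((\<lambda>s. det (B s)) has_field_derivative
    c m * det (mat m m (\<lambda>(i, j). B a $$ (i, j)))) (at a)"
  proof (rule has_field_derivative_det_zero_border)
    show "B s \<in> carrier_mat (Suc m) (Suc m)" for s by (simp add: B_def)
    show "isCont (\<lambda>s. B s $$ (i, j)) a" if "i \<le> m" "j \<le> m" for i j
      using that cont
      by (cases "i = m"; cases "j = m"; cases "i = j") (auto simp: B_def intro!: continuous_intros)
    show "B a $$ (m, j) = 0" if "j \<le> m" for j
      using that zero by (auto simp: B_def)
    show "B a $$ (i, m) = 0" if "i \<le> m" for i
      using that zero by (auto simp: B_def)
    show "((\<lambda>s. B s $$ (i, m)) has_field_derivative c i) (at a)" if "i \<le> m" for i
      using that F G H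
      by (cases "i = m") (auto simp: B_def c_def intro!: derivative_eq_intros)
  qed
  moreover have "det (mat m m (\<lambda>(i, j). B a $$ (i, j))) = G a ^ m * weighted_complexity V E \<omega>"
  proof -
    \<comment> \<open>At \<open>a\<close> the remaining block is \<open>G a\<close> times the
      reduced Laplacian; its size \<open>m\<close> gives the exponent
      \<open>card V - 1\<close>.\<close>
    have "H a = - G a" using zero(2) by (simp add: add_eq_0_iff)
    then have "mat m m (\<lambda>(i, j). B a $$ (i, j))
      = G a \<cdot>\<^sub>m mat m m (\<lambda>(i, j). (if i = j then \<Sum>k\<le>m. w i k else 0) - w i j)"
      by (intro eq_matI) (auto simp: B_def zero(1) deg algebra_simps)
    then show ?thesis
      using weighted_complexity_eq_det[OF v', of E \<omega>, folded w_def] by simp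
  qed
  ultimately show ?thesis
    unfolding M_def[symmetric] detM by (simp add: c_def Suc mult_ac)
qed

theorem theorem0p1:
  fixes V :: "'v set" and E :: "'v set set" and \<omega> :: "'v set \<Rightarrow> complex"
    and v :: "nat \<Rightarrow> 'v"
    and f g h :: "complex \<Rightarrow> complex \<Rightarrow> complex"
    and U :: "(complex \<times> complex) set" and \<alpha> \<beta> :: complex
  assumes "finite V" and "simple_graph V E"
    and "bij_betw v {0..<card V} V"
    and "open U" and "(\<alpha>, \<beta>) \<in> U"
    and "partially_differentiable_on f U"
    and "partially_differentiable_on g U"
    and "partially_differentiable_on h U"
    and "f \<alpha> \<beta> = 0" and "g \<alpha> \<beta> + h \<alpha> \<beta> = 0"
  shows "((\<lambda>s. Phi (card V) v E \<omega> f g h s \<beta>) has_field_derivative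
            g \<alpha> \<beta> ^ (card V - 1) *
            (partial_fst f \<alpha> \<beta> * of_nat (card V)
              + (partial_fst g \<alpha> \<beta> + partial_fst h \<alpha> \<beta>) * (2 * total_weight E \<omega>)) *
            weighted_complexity V E \<omega>) (at \<alpha>)
       \<and> ((\<lambda>t. Phi (card V) v E \<omega> f g h \<alpha> t) has_field_derivative
            g \<alpha> \<beta> ^ (card V - 1) *
            (partial_snd f \<alpha> \<beta> * of_nat (card V)
              + (partial_snd g \<alpha> \<beta> + partial_snd h \<alpha> \<beta>) * (2 * total_weight E \<omega>)) *
            weighted_complexity V E \<omega>) (at \<beta>)"
proof -
  have partials: "((\<lambda>s. k s \<beta>) has_field_derivative partial_fst k \<alpha> \<beta>) (at \<alpha>)"
    "((\<lambda>t. k \<alpha> t) has_field_derivative partial_snd k \<alpha> \<beta>) (at \<beta>)"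
    if "partially_differentiable_on k U" for k
    using that assms(5)
    by (auto simp: partially_differentiable_on_def partial_fst_def partial_snd_def
        field_differentiable_derivI)
  show ?thesis
    unfolding Phi_def
    using has_field_derivative_det_degree_adjacency[OF assms(1-3) partials(1)[OF assms(6)]
        partials(1)[OF assms(7)] partials(1)[OF assms(8)] assms(9,10)]
      has_field_derivative_det_degree_adjacency[OF assms(1-3) partials(2)[OF assms(6)]
        partials(2)[OF assms(7)] partials(2)[OF assms(8)] assms(9,10)]
    by blast
qed

end
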